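(* Let $\mathbb F_q$ be a finite field with $q$ elements, let $r\ge1$, let $\square,\tilde\square\subseteq\mathbb R^r$ be integral convex polytopes with Minkowski sum $\square+\tilde\square$, and let $U=\square\cap\mathbb Z^r$, $\tilde U=\tilde\square\cap\mathbb Z^r$, $T(\mathbb F_q)=(\mathbb F_q^* )^r$, $n=|T(\mathbb F_q)|$. Let $t$ be a non-negative integer and assume (i) $|\tilde U|>t$; (ii) $d(C_{\square+\tilde\square})>t$; (iii) $d(C_{\tilde\square})>n-d(C_\square)$. Let $y:T(\mathbb F_q)\to\mathbb F_q$ be a received word of the form $y(P)=f_0(P)+e(P)$, where $f_0\in\mathbb F_q[U]$ and $e:T(\mathbb F_q)\to\mathbb F_q$ has support $T\subseteq T(\mathbb F_q)$ with $|T|\le t$. Let $(g,h)\in\mathbb F_q[\tilde U]\oplus\mathbb F_q[U+\tilde U]$ be in the kernel of the linear map $$\mathbb F_q[\tilde U]\oplus\mathbb F_q[U+\tilde U]\to\mathbb F_q^n,\qquad (g,h)\mapsto\bigl(g(P)y(P)-h(P)\bigr)_{P\in T(\mathbb F_q)},$$ with $g|_T=0$ and $g\ne0$ as a function on $T(\mathbb F_q)$. Then there is a unique $f$ such that $h=g\cdot f$; that is, there is an $f\in\mathbb F_q[U]$ with $h(P)=g(P)f(P)$ for all $P\in T(\mathbb F_q)$, and its codeword $(f(P))_{P\in T(\mathbb F_q)}\in C_\square$ is unique.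
   Context: For a finite set $W\subseteq\mathbb Z^r$, $\mathbb F_q[W]$ is the $\mathbb F_q$-linear span of the monomials $X_1^{w_1}\cdots X_r^{w_r}$, $w\in W$, in $\mathbb F_q[X_1^{\pm1},\dots,X_r^{\pm1}]$. $U+\tilde U=\{u+\tilde u: u\in U,\tilde u\in\tilde U\}$. For an integral convex polytope $\square\subseteq\mathbb R^r$, the toric code $C_\square$ is the image of the evaluation map $\mathbb F_q[\square\cap\mathbb Z^r]\to\mathbb F_q^{n}$, $f\mapsto(f(P))_{P\in T(\mathbb F_q)}$, and $d(C)$ denotes the minimum distance (minimal Hamming weight of a non-zero codeword) of a linear code $C$. The support of $e$ is the set of $P$ with $e(P)\ne0$. *)

theory Defs
  imports
    "HOL-Analysis.Analysis"
    "HOL-Library.Poly_Mapping"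
    "HOL-Library.Set_Algebras"
begin

text \<open>
  The Laurent polynomial ring in variables indexed by \<open>'r\<close> over \<open>'a\<close> is the group
  algebra of the exponent group \<open>int ^ 'r\<close>, i.e. the type \<open>(int ^ 'r) \<Rightarrow>\<^sub>0 'a\<close> of finitely
  supported coefficient functions with its convolution product.  Exponents may be negative.
\<close>

type_synonym ('a, 'r) laurent = "(int ^ 'r) \<Rightarrow>\<^sub>0 'a"

definition laurent_monomial :: "int ^ 'r \<Rightarrow> ('a::field, 'r::finite) laurent" where
  "laurent_monomial w = Poly_Mapping.single w 1"

definition laurent_scale :: "'a::field \<Rightarrow> ('a, 'r::finite) laurent \<Rightarrow> ('a, 'r) laurent" where
  "laurent_scale c p = Poly_Mapping.single 0 c * p"

lemma vector_space_laurent_scale: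
  "vector_space (laurent_scale :: 'a::field \<Rightarrow> ('a, 'r::finite) laurent \<Rightarrow> ('a, 'r) laurent)"
proof
  fix a b :: 'a and x y :: "('a, 'r) laurent"
  show "laurent_scale a (x + y) = laurent_scale a x + laurent_scale a y"
    by (simp add: laurent_scale_def distrib_left)
  show "laurent_scale (a + b) x = laurent_scale a x + laurent_scale b x"
    by (simp add: laurent_scale_def single_add distrib_right)
  show "laurent_scale a (laurent_scale b x) = laurent_scale (a * b) x"
    by (simp add: laurent_scale_def mult_single flip: mult.assoc)
  show "laurent_scale 1 x = x"
    by (simp add: laurent_scale_def)
qed

global_interpretation laurent: vector_space laurent_scale
  by (rule vector_space_laurent_scale)

definition laurent_space :: "(int ^ 'r) set \<Rightarrow> ('a::field, 'r::finite) laurent set" where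
  "laurent_space W = laurent.span (laurent_monomial ` W)"

definition laurent_eval :: "('a::field, 'r::finite) laurent \<Rightarrow> 'a ^ 'r \<Rightarrow> 'a" where
  "laurent_eval p P =
     (\<Sum>w\<in>Poly_Mapping.keys p. Poly_Mapping.lookup p w * (\<Prod>i\<in>UNIV. (P $ i) powi (w $ i)))"

definition lattice_vec :: "int ^ 'r \<Rightarrow> real ^ 'r" where
  "lattice_vec w = (\<chi> i. real_of_int (w $ i))"

definition integral_polytope :: "(real ^ 'r) set \<Rightarrow> bool" where
  "integral_polytope S \<longleftrightarrow> (\<exists>V. finite V \<and> V \<subseteq> range lattice_vec \<and> S = convex hull V)"

definition lattice_points :: "(real ^ 'r) set \<Rightarrow> (int ^ 'r) set" where
  "lattice_points S = {w. lattice_vec w \<in> S}"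

definition torus :: "('a::zero ^ 'r) set" where
  "torus = {P. \<forall>i. P $ i \<noteq> 0}"

text \<open>
  A word of length \<open>n = card torus\<close> is a function on all of \<open>'a ^ 'r\<close> that is \<open>0\<close> off the
  torus.  So equality of words is equality on the torus, and the coordinates off the torus do
  not contribute to Hamming weights.
\<close>

definition toric_word :: "('a::field, 'r::finite) laurent \<Rightarrow> 'a ^ 'r \<Rightarrow> 'a" where
  "toric_word p = (\<lambda>P. if P \<in> torus then laurent_eval p P else 0)"

definition toric_code :: "(real ^ 'r) set \<Rightarrow> ('a::field ^ 'r::finite \<Rightarrow> 'a) set" where
  "toric_code S = toric_word ` laurent_space (lattice_points S)"

definition hamming_weight :: "('i \<Rightarrow> 'a::zero) \<Rightarrow> nat" where
  "hamming_weight c = card {i. c i \<noteq> 0}"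

text \<open>
  A code without non-zero codewords gets minimum distance \<open>Inf {} = 0\<close>.  Among toric codes
  this is only the code of the empty polytope, as a monomial vanishes nowhere on the torus.
\<close>

definition min_distance :: "('i \<Rightarrow> 'a::zero) set \<Rightarrow> nat" where
  "min_distance C = Inf (hamming_weight ` (C - {\<lambda>_. 0}))"

end

theory Submission
  imports Defs
begin

text \<open>
  The witness is \<open>f\<^sub>0\<close> itself: \<open>g\<close> vanishes on the error positions, and \<open>y = f\<^sub>0\<close> elsewhere.  If
  \<open>f\<close> were another solution with a different codeword, then \<open>g\<close> and \<open>f - f\<^sub>0\<close> would be non-zero
  codewords with disjoint supports, of total size at least
  \<open>min_distance (toric_code S') + min_distance (toric_code S) > n\<close>.
\<close>

text \<open>Exponents outside \<open>keys p\<close> have coefficient 0. A common index set lets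
  evaluations of polynomials with different supports be subtracted term by term.\<close>

lemma laurent_eval_superset:
  fixes p :: "('a::field, 'r::finite) laurent"
  assumes "finite A" "Poly_Mapping.keys p \<subseteq> A"
  shows "laurent_eval p P =
    (\<Sum>w\<in>A. Poly_Mapping.lookup p w * (\<Prod>i\<in>UNIV. (P $ i) powi (w $ i)))"
  unfolding laurent_eval_def
  by (rule sum.mono_neutral_left) (use assms in \<open>auto simp: in_keys_iff\<close>)

lemma laurent_eval_diff:
  "laurent_eval (p - q) P = laurent_eval p P - laurent_eval q P"
proof -
  let ?A = "Poly_Mapping.keys p \<union> Poly_Mapping.keys q"
  have "Poly_Mapping.keys (p - q) \<subseteq> ?A"
    by (auto simp: in_keys_iff lookup_minus)
  then show ?thesis
    by (simp add: laurent_eval_superset[where A = ?A] lookup_minus left_diff_distrib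
        sum_subtractf)
qed

lemma min_distance_le:
  assumes "c \<in> C" "c i \<noteq> 0"
  shows "min_distance C \<le> hamming_weight c"
  unfolding min_distance_def by (rule cInf_lower) (use assms in auto)

text \<open>Words are 0 off the torus, so the Hamming weight counts only torus points. The point
  \<open>P\<close> ensures that the codeword of \<open>p\<close> is non-zero.\<close>

lemma min_distance_toric_code_le:
  fixes p :: "('a::field, 'r::finite) laurent"
  assumes "p \<in> laurent_space (lattice_points S)" "P \<in> torus" "laurent_eval p P \<noteq> 0"
  shows "min_distance (toric_code S :: ('a ^ 'r \<Rightarrow> 'a) set)
    \<le> card {P \<in> torus. laurent_eval p P \<noteq> 0}"
proof -
  have "min_distance (toric_code S :: ('a ^ 'r \<Rightarrow> 'a) set) \<le> hamming_weight (toric_word p)"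
    by (rule min_distance_le[where i = P])
      (use assms in \<open>auto simp: toric_code_def toric_word_def\<close>)
  also have "{P. toric_word p P \<noteq> 0} = {P \<in> torus. laurent_eval p P \<noteq> 0}"
    by (auto simp: toric_word_def)
  then have "hamming_weight (toric_word p) = card {P \<in> torus. laurent_eval p P \<noteq> 0}"
    by (simp add: hamming_weight_def)
  finally show ?thesis .
qed

theorem lemma6p2:
  fixes S S' :: "(real ^ 'r::finite) set"
    and U U' :: "(int ^ 'r) set"
    and n t :: nat
    and y e :: "'a::{field, finite} ^ 'r \<Rightarrow> 'a"
    and T :: "('a ^ 'r) set"
    and f\<^sub>0 g h :: "('a, 'r) laurent"
  assumes "integral_polytope S" and "integral_polytope S'"
    and "U = lattice_points S" and "U' = lattice_points S'"
    and "n = card (torus :: ('a ^ 'r) set)"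
    and "card U' > t"
    and "min_distance (toric_code (S + S') :: ('a ^ 'r \<Rightarrow> 'a) set) > t"
    and "int (min_distance (toric_code S' :: ('a ^ 'r \<Rightarrow> 'a) set))
           > int n - int (min_distance (toric_code S :: ('a ^ 'r \<Rightarrow> 'a) set))"
    and "f\<^sub>0 \<in> laurent_space U"
    and "T = {P \<in> torus. e P \<noteq> 0}" and "card T \<le> t"
    and "\<forall>P\<in>torus. y P = laurent_eval f\<^sub>0 P + e P"
    and "g \<in> laurent_space U'" and "h \<in> laurent_space (U + U')"
    and "\<forall>P\<in>torus. laurent_eval g P * y P - laurent_eval h P = 0"
    and "\<forall>P\<in>T. laurent_eval g P = 0"
    and "\<exists>P\<in>torus. laurent_eval g P \<noteq> 0"
  shows "\<exists>f\<in>laurent_space U.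
           (\<forall>P\<in>torus. laurent_eval h P = laurent_eval g P * laurent_eval f P) \<and>
           (\<forall>f'\<in>laurent_space U.
              (\<forall>P\<in>torus. laurent_eval h P = laurent_eval g P * laurent_eval f' P)
              \<longrightarrow> toric_word f' = toric_word f)"
proof (intro bexI conjI ballI impI)
  show "f\<^sub>0 \<in> laurent_space U" by fact
  show h: "laurent_eval h P = laurent_eval g P * laurent_eval f\<^sub>0 P" if "P \<in> torus" for P
    \<comment> \<open>On \<open>T\<close>, \<open>g\<close> vanishes, hence so does
      \<open>h = g * y\<close>; off \<open>T\<close> the error is 0 and \<open>y\<close> agrees with
      \<open>f\<^sub>0\<close>.\<close>
    using assms(10,12,15,16) that by (cases "P \<in> T") auto
  fix f assume f: "f \<in> laurent_space U"
    and hf: "\<forall>P\<in>torus. laurent_eval h P = laurent_eval g P * laurent_eval f P"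
  show "toric_word f = toric_word f\<^sub>0"
  proof (rule ccontr)
    assume "toric_word f \<noteq> toric_word f\<^sub>0"
    \<comment> \<open>Both words take the default value 0 off the torus, so they can differ only at
      a torus point.\<close>
    then obtain P where P: "P \<in> torus" "laurent_eval (f - f\<^sub>0) P \<noteq> 0"
      by (auto simp: toric_word_def fun_eq_iff laurent_eval_diff split: if_splits)
    obtain Q where Q: "Q \<in> torus" "laurent_eval g Q \<noteq> 0"
      using assms(17) by auto
    let ?A = "{P \<in> torus. laurent_eval g P \<noteq> 0}"
    let ?B = "{P \<in> torus. laurent_eval (f - f\<^sub>0) P \<noteq> 0}"
    have "f - f\<^sub>0 \<in> laurent_space (lattice_points S)"
      using f assms(3,9) by (simp add: laurent_space_def laurent.span_diff)
    from min_distance_toric_code_le[OF this P]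
    have B: "min_distance (toric_code S :: ('a ^ 'r \<Rightarrow> 'a) set) \<le> card ?B" .
    have A: "min_distance (toric_code S' :: ('a ^ 'r \<Rightarrow> 'a) set) \<le> card ?A"
      using min_distance_toric_code_le assms(4,13) Q by blast
    \<comment> \<open>Subtracting the two factorizations of \<open>h\<close> gives
      \<open>g * (f - f\<^sub>0) = 0\<close> at each torus point, and a field has no zero
      divisors.\<close>
    have "?A \<inter> ?B = {}"
      using h hf by (auto simp: laurent_eval_diff)
    then have "card ?A + card ?B = card (?A \<union> ?B)"
      by (simp add: card_Un_disjoint)
    also have "\<dots> \<le> n"
      unfolding assms(5) by (rule card_mono) auto
    finally show False
      \<comment> \<open>The hypothesis on the two minimum distances says that their sum exceeds
        \<open>n\<close>, whereas \<open>A\<close> and \<open>B\<close> bound it by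
        \<open>n\<close>.\<close>
      using A B assms(8) by linarith
  qed
qed

end
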